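(* Let $q$ be a non-zero real number. There are infinitely many unicyclic graphs of maximum degree three that exhibit perfect pair state transfer with respect to the $q$-Laplacian matrix.
   Context: Graphs here are finite, simple, unweighted, without potentials; a unicyclic graph is a connected graph containing exactly one cycle. For a graph with adjacency matrix $A$ and diagonal degree matrix $\Delta$, the $q$-Laplacian matrix is $\mathscr{L}=(1-q^2)I+q^2\Delta-qA$, and $U_{\mathscr{L}}(t)=\exp(it\mathscr{L})$. A pair state is a vector $\frac{1}{\sqrt2}(\mathbf{e}_a-\mathbf{e}_b)$ with $a\ne b$ vertices, where $\mathbf{e}_a$ is the characteristic vector of $a$. Perfect pair state transfer occurs if there are two linearly independent pair states $\mathbf{x},\mathbf{y}$, some $\tau>0$ and $\gamma\in\mathbb{C}$ with $U_{\mathscr{L}}(\tau)\mathbf{x}=\gamma\mathbf{y}$. *)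

theory Defs
  imports
    "Graph_Theory.Graph_Theory"
    "Jordan_Normal_Form.Matrix"
    Complex_Main
begin

text \<open>
  A finite simple graph is a symmetric loop-free digraph \<^locale>\<open>pair_graph\<close>. Its vertices are
  taken to be the numbers below its order, so that vertices index the matrices below directly.
  Every finite simple graph is isomorphic to one of this form.
\<close>

definition order :: "nat pair_pre_digraph \<Rightarrow> nat" where
  "order G = card (pverts G)"

definition simple_graph :: "nat pair_pre_digraph \<Rightarrow> bool" where
  "simple_graph G \<longleftrightarrow> pair_graph G \<and> pverts G = {0..<order G}"

definition isomorphic :: "nat pair_pre_digraph \<Rightarrow> nat pair_pre_digraph \<Rightarrow> bool" where
  "isomorphic G H \<longleftrightarrow> digraph_iso (with_proj G) (with_proj H)"

definition degree :: "nat pair_pre_digraph \<Rightarrow> nat \<Rightarrow> nat" where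
  "degree G v = out_degree (with_proj G) v"

definition max_degree :: "nat pair_pre_digraph \<Rightarrow> nat" where
  "max_degree G = Max (degree G ` pverts G)"

text \<open>
  In a symmetric digraph \<^const>\<open>pre_digraph.cycle\<close> also admits traversing one edge back and
  forth, hence the lower bound on the length. A cycle of the undirected graph is identified with
  its set of edges, which makes it independent of starting point and orientation.
\<close>

definition cycles :: "nat pair_pre_digraph \<Rightarrow> nat set set set" where
  "cycles G = {(\<lambda>(u, v). {u, v}) ` set p | p.
                 pre_digraph.cycle (with_proj G) p \<and> 3 \<le> length p}"

definition unicyclic :: "nat pair_pre_digraph \<Rightarrow> bool" where
  "unicyclic G \<longleftrightarrow> Digraph_Component.connected (with_proj G) \<and> (\<exists>!C. C \<in> cycles G)"

definition adjacency_matrix :: "nat pair_pre_digraph \<Rightarrow> real mat" where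
  "adjacency_matrix G =
     mat (order G) (order G) (\<lambda>(i, j). if (i, j) \<in> parcs G then 1 else 0)"

definition degree_matrix :: "nat pair_pre_digraph \<Rightarrow> real mat" where
  "degree_matrix G =
     mat (order G) (order G) (\<lambda>(i, j). if i = j then real (degree G i) else 0)"

definition q_laplacian :: "real \<Rightarrow> nat pair_pre_digraph \<Rightarrow> real mat" where
  "q_laplacian q G =
     (1 - q\<^sup>2) \<cdot>\<^sub>m 1\<^sub>m (order G) + q\<^sup>2 \<cdot>\<^sub>m degree_matrix G - q \<cdot>\<^sub>m adjacency_matrix G"

text \<open>
  The matrix exponential of a square matrix; each of the entrywise series converges absolutely.
\<close>

definition mat_exp :: "complex mat \<Rightarrow> complex mat" where
  "mat_exp M = mat (dim_row M) (dim_row M) (\<lambda>(i, j). \<Sum>k. (M ^\<^sub>m k) $$ (i, j) / fact k)"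

definition transition_matrix :: "real mat \<Rightarrow> real \<Rightarrow> complex mat" where
  "transition_matrix L t = mat_exp ((\<i> * complex_of_real t) \<cdot>\<^sub>m map_mat complex_of_real L)"

definition pair_states :: "nat \<Rightarrow> complex vec set" where
  "pair_states n =
     {complex_of_real (1 / sqrt 2) \<cdot>\<^sub>v (unit_vec n a - unit_vec n b) | a b.
        a < n \<and> b < n \<and> a \<noteq> b}"

definition perfect_pair_state_transfer :: "real \<Rightarrow> nat pair_pre_digraph \<Rightarrow> bool" where
  "perfect_pair_state_transfer q G \<longleftrightarrow>
     (\<exists>x \<in> pair_states (order G). \<exists>y \<in> pair_states (order G).
        (\<forall>c d. c \<cdot>\<^sub>v x + d \<cdot>\<^sub>v y = 0\<^sub>v (order G) \<longrightarrow> c = 0 \<and> d = 0) \<and>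
        (\<exists>\<tau> > 0. \<exists>\<gamma>. transition_matrix (q_laplacian q G) \<tau> *\<^sub>v x = \<gamma> \<cdot>\<^sub>v y))"

end

theory Submission
  imports Defs
begin

text \<open>
  The graphs are hexagons with a path attached at one vertex. Numbering the hexagon \<open>0, ..., 5\<close>
  and attaching the tail at \<open>5\<close>, the reflection \<open>0 \<leftrightarrow> 4\<close>, \<open>1 \<leftrightarrow> 3\<close> is an automorphism that fixes
  \<open>2\<close>, \<open>5\<close> and the whole tail. The vectors that it negates form the plane spanned by
  \<open>x = e\<^sub>0 - e\<^sub>4\<close> and \<open>y = e\<^sub>1 - e\<^sub>3\<close>, which is therefore invariant under the \<open>q\<close>-Laplacian \<open>L\<close>, however
  long the tail is. The four vertices involved have degree two, so each has diagonal entry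
  \<open>(1 - q\<^sup>2) + 2 q\<^sup>2 = 1 + q\<^sup>2\<close>, and \<open>0\<close> is joined to \<open>1\<close> and \<open>4\<close> to \<open>3\<close>; thus \<open>L x = (1 + q\<^sup>2) x - q y\<close> and
  \<open>L y = (1 + q\<^sup>2) y - q x\<close> (\<open>q_laplacian_swaps_pairs\<close>).

  On this plane \<open>L\<close> acts like the adjacency matrix of a single edge, up to a shift and the factor
  \<open>-q\<close>: \<open>x + y\<close> and \<open>x - y\<close> are eigenvectors, and \<open>exp (\<i> t L) x\<close> is, up to a phase,
  \<open>cos (t q) x - \<i> sin (t q) y\<close> (\<open>transition_matrix_on_swapped_pair\<close>). At time \<open>pi / (2 \<bar>q\<bar>)\<close> the state
  has moved entirely from \<open>x\<close> to \<open>y\<close>.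

  That the hexagon is the only cycle follows from looking at extreme vertices: every vertex of a
  cycle has two neighbours on it, and the largest vertex of a cycle can only be \<open>5\<close>, since \<open>5\<close> is the only
  vertex with two smaller neighbours. From there the remaining edges are forced one by one.
\<close>

section \<open>The exponential of a matrix on an eigenvector\<close>

lemma norm_pow_mat_entry_le:
  fixes M :: "complex mat"
  assumes M: "M \<in> carrier_mat n n"
    and B: "\<And>i j. i < n \<Longrightarrow> j < n \<Longrightarrow> norm (M $$ (i, j)) \<le> B"
    and i: "i < n"
  shows "j < n \<Longrightarrow> norm ((M ^\<^sub>m k) $$ (i, j)) \<le> (real n * B) ^ k"
proof (induction k arbitrary: j)
  case 0
  then show ?case using M i by (simp add: one_mat_def)
next
  case (Suc k)
  have "0 \<le> B" using B[OF i i] norm_ge_zero order_trans by blast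
  have "(M ^\<^sub>m Suc k) $$ (i, j) = (\<Sum>l<n. (M ^\<^sub>m k) $$ (i, l) * M $$ (l, j))"
    using M i Suc.prems by (simp add: scalar_prod_def atLeast0LessThan)
  also have "norm \<dots> \<le> (\<Sum>l<n. (real n * B) ^ k * B)"
    using Suc \<open>0 \<le> B\<close> by (intro sum_norm_le) (auto simp: norm_mult intro!: mult_mono B)
  also have "\<dots> = (real n * B) ^ Suc k" by (simp add: algebra_simps)
  finally show ?case .
qed

text \<open>
  By the entrywise bound above, the exponential series of a scalar dominates each entry; this is what
  permits exchanging the series with the finite sums of a matrix-vector product.
\<close>

lemma summable_mat_exp_entry:
  fixes M :: "complex mat"
  assumes M: "M \<in> carrier_mat n n" and "i < n" "j < n"
  shows "summable (\<lambda>k. (M ^\<^sub>m k) $$ (i, j) / fact k)"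
proof (rule summable_comparison_test')
  define B where "B = (\<Sum>p\<in>{..<n} \<times> {..<n}. norm (M $$ p))"
  have B: "norm (M $$ (i, j)) \<le> B" if "i < n" "j < n" for i j
    unfolding B_def using that by (intro member_le_sum) auto
  show "summable (\<lambda>k. inverse (fact k) * (real n * B) ^ k)" by (rule summable_exp)
  show "norm ((M ^\<^sub>m k) $$ (i, j) / fact k) \<le> inverse (fact k) * (real n * B) ^ k" for k
    using norm_pow_mat_entry_le[OF M B \<open>i < n\<close> \<open>j < n\<close>, of k]
    by (simp add: norm_divide field_simps)
qed

lemma pow_mat_mult_eigenvector:
  fixes M :: "complex mat"
  assumes M: "M \<in> carrier_mat n n" and v: "v \<in> carrier_vec n" and eig: "M *\<^sub>v v = c \<cdot>\<^sub>v v"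
  shows "M ^\<^sub>m k *\<^sub>v v = c ^ k \<cdot>\<^sub>v v"
proof (induction k)
  case 0
  then show ?case using M v by simp
next
  case (Suc k)
  have "M ^\<^sub>m Suc k *\<^sub>v v = M ^\<^sub>m k *\<^sub>v (M *\<^sub>v v)"
    using assoc_mult_mat_vec[OF pow_carrier_mat[OF M] M v] by simp
  also have "\<dots> = c \<cdot>\<^sub>v (M ^\<^sub>m k *\<^sub>v v)"
    unfolding eig using mult_mat_vec[OF pow_carrier_mat[OF M] v] .
  finally show ?case using Suc by (simp add: smult_smult_assoc)
qed

lemma mat_exp_mult_eigenvector:
  fixes M :: "complex mat"
  assumes M: "M \<in> carrier_mat n n" and v: "v \<in> carrier_vec n" and eig: "M *\<^sub>v v = c \<cdot>\<^sub>v v"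
  shows "mat_exp M *\<^sub>v v = exp c \<cdot>\<^sub>v v"
proof (rule eq_vecI)
  show "dim_vec (mat_exp M *\<^sub>v v) = dim_vec (exp c \<cdot>\<^sub>v v)"
    using M v by (simp add: mat_exp_def)
  fix i assume "i < dim_vec (exp c \<cdot>\<^sub>v v)"
  then have i: "i < n" using v by simp
  note sm = summable_mat_exp_entry[OF M i]
  have pow: "(\<Sum>j<n. (M ^\<^sub>m k) $$ (i, j) * v $ j) = c ^ k * v $ i" for k
  proof -
    have "(M ^\<^sub>m k *\<^sub>v v) $ i = (\<Sum>j<n. (M ^\<^sub>m k) $$ (i, j) * v $ j)"
      using M v i by (simp add: scalar_prod_def atLeast0LessThan)
    then show ?thesis using pow_mat_mult_eigenvector[OF assms, of k] v i by simp
  qed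
  have "(mat_exp M *\<^sub>v v) $ i = (\<Sum>j<n. (\<Sum>k. (M ^\<^sub>m k) $$ (i, j) / fact k) * v $ j)"
    using M v i by (simp add: mat_exp_def scalar_prod_def atLeast0LessThan)
  also have "\<dots> = (\<Sum>j<n. \<Sum>k. (M ^\<^sub>m k) $$ (i, j) / fact k * v $ j)"
    using sm by (intro sum.cong refl suminf_mult2) auto
  also have "\<dots> = (\<Sum>k. \<Sum>j<n. (M ^\<^sub>m k) $$ (i, j) / fact k * v $ j)"
    using sm by (intro suminf_sum[symmetric] summable_mult2) auto
  also have "\<dots> = (\<Sum>k. (c ^ k /\<^sub>R fact k) * v $ i)"
  proof (rule suminf_cong)
    fix k
    have "(\<Sum>j<n. (M ^\<^sub>m k) $$ (i, j) / fact k * v $ j)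
        = (\<Sum>j<n. (M ^\<^sub>m k) $$ (i, j) * v $ j) / fact k"
      by (simp add: sum_divide_distrib)
    also have "\<dots> = (c ^ k /\<^sub>R fact k) * v $ i"
      unfolding pow by (simp add: scaleR_conv_of_real divide_inverse)
    finally show "(\<Sum>j<n. (M ^\<^sub>m k) $$ (i, j) / fact k * v $ j) = (c ^ k /\<^sub>R fact k) * v $ i" .
  qed
  also have "\<dots> = exp c * v $ i"
    unfolding exp_def by (rule suminf_mult2[symmetric]) (rule summable_exp_generic)
  finally show "(mat_exp M *\<^sub>v v) $ i = (exp c \<cdot>\<^sub>v v) $ i" using v i by simp
qed

text \<open>
  The hypotheses make \<open>x + y\<close> and \<open>x - y\<close> eigenvectors, for \<open>a + b\<close> and \<open>a - b\<close>, so the claim is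
  Euler's formula applied to \<open>x\<close> as half the sum of the two.
\<close>

lemma transition_matrix_on_swapped_pair:
  fixes L :: "real mat" and x y :: "complex vec" and a b t :: real
  assumes L: "L \<in> carrier_mat n n" and x: "x \<in> carrier_vec n" and y: "y \<in> carrier_vec n"
    and Lx: "map_mat complex_of_real L *\<^sub>v x = of_real a \<cdot>\<^sub>v x + of_real b \<cdot>\<^sub>v y"
    and Ly: "map_mat complex_of_real L *\<^sub>v y = of_real a \<cdot>\<^sub>v y + of_real b \<cdot>\<^sub>v x"
  shows "transition_matrix L t *\<^sub>v x =
    exp (\<i> * of_real (t * a)) \<cdot>\<^sub>v (of_real (cos (t * b)) \<cdot>\<^sub>v x + (\<i> * of_real (sin (t * b))) \<cdot>\<^sub>v y)"
proof -
  define K where "K = map_mat complex_of_real L"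
  define s where "s = \<i> * complex_of_real t"
  define U where "U = mat_exp (s \<cdot>\<^sub>m K)"
  have K: "K \<in> carrier_mat n n" using L by (simp add: K_def)
  have U: "U \<in> carrier_mat n n" using K by (simp add: U_def mat_exp_def)
  have exp_cis: "exp (s * of_real b) = cis (t * b)" "exp (- (s * of_real b)) = cis (- (t * b))"
    by (simp_all add: s_def cis_conv_exp mult.assoc)
  note Lx = Lx[folded K_def] and Ly = Ly[folded K_def]
  have scale: "(s \<cdot>\<^sub>m K) *\<^sub>v v = s \<cdot>\<^sub>v (K *\<^sub>v v)" if "v \<in> carrier_vec n" for v
    using K that by (intro eq_vecI) (auto simp: row_smult)
  have "(s \<cdot>\<^sub>m K) *\<^sub>v (x + y) = (s * of_real (a + b)) \<cdot>\<^sub>v (x + y)"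
    using x y by (subst scale, simp, subst mult_add_distrib_mat_vec[OF K x y], unfold Lx Ly)
      (intro eq_vecI, auto simp: algebra_simps)
  then have plus: "U *\<^sub>v (x + y) = exp (s * of_real (a + b)) \<cdot>\<^sub>v (x + y)"
    unfolding U_def using K x y by (intro mat_exp_mult_eigenvector[of _ n]) auto
  have "(s \<cdot>\<^sub>m K) *\<^sub>v (x - y) = (s * of_real (a - b)) \<cdot>\<^sub>v (x - y)"
    using x y by (subst scale, simp, subst mult_minus_distrib_mat_vec[OF K x y], unfold Lx Ly)
      (intro eq_vecI, auto simp: algebra_simps)
  then have minus: "U *\<^sub>v (x - y) = exp (s * of_real (a - b)) \<cdot>\<^sub>v (x - y)"
    unfolding U_def using K x y by (intro mat_exp_mult_eigenvector[of _ n]) auto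
  have half: "x = (1/2) \<cdot>\<^sub>v ((x + y) + (x - y))"
    using x y by (intro eq_vecI) (auto simp: field_simps)
  have "U *\<^sub>v x = (1/2) \<cdot>\<^sub>v (U *\<^sub>v (x + y) + U *\<^sub>v (x - y))"
    by (subst half, subst mult_mat_vec[OF U], use x y in simp,
        subst mult_add_distrib_mat_vec[OF U]) (use x y in simp_all)
  also have "\<dots> = exp (s * of_real a) \<cdot>\<^sub>v
      (((exp (s * of_real b) + exp (- (s * of_real b))) / 2) \<cdot>\<^sub>v x
        + ((exp (s * of_real b) - exp (- (s * of_real b))) / 2) \<cdot>\<^sub>v y)"
    unfolding plus minus using x y
    by (intro eq_vecI) (auto simp: distrib_left right_diff_distrib exp_diff exp_add exp_minus field_simps)
  also have "(exp (s * of_real b) + exp (- (s * of_real b))) / 2 = of_real (cos (t * b))"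
    unfolding exp_cis by (simp add: complex_eq_iff)
  also have "(exp (s * of_real b) - exp (- (s * of_real b))) / 2 = \<i> * of_real (sin (t * b))"
    unfolding exp_cis by (simp add: complex_eq_iff)
  finally show ?thesis by (simp add: transition_matrix_def U_def s_def K_def mult_ac)
qed

section \<open>Cycles in graphs\<close>

text \<open>
  In terms of list positions: the tail of the vertex list, whose distinctness characterises a
  cycle, consists of the heads of the arcs.
\<close>

lemma awalk_consecutive:
  assumes "pcas u p v" "p \<noteq> []"
  shows "fst (hd p) = u \<and> snd (last p) = v \<and> tl (pawalk_verts u p) = map snd p
    \<and> (\<forall>i. Suc i < length p \<longrightarrow> snd (p ! i) = fst (p ! Suc i))"
  using assms
proof (induction p arbitrary: u)
  case (Cons e p)
  show ?case
  proof (cases "p = []")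
    case False
    then have IH: "fst (hd p) = snd e" "snd (last p) = v" "tl (pawalk_verts (snd e) p) = map snd p"
      "\<And>i. Suc i < length p \<Longrightarrow> snd (p ! i) = fst (p ! Suc i)"
      using Cons by auto
    have "snd ((e # p) ! i) = fst ((e # p) ! Suc i)" if "Suc i < length (e # p)" for i
      using that IH False by (cases i) (auto simp: hd_conv_nth)
    moreover have "pawalk_verts (snd e) p = snd e # map snd p"
      using IH False by (cases p) auto
    ultimately show ?thesis using Cons.prems IH False by auto
  qed (use Cons.prems in auto)
qed simp

lemma cycle_subset_edges:
  assumes "C \<in> cycles G"
  shows "C \<noteq> {}" "\<And>e. e \<in> C \<Longrightarrow> \<exists>u v. e = {u, v} \<and> (u, v) \<in> parcs G"
  using assms
  by (auto simp: cycles_def pre_digraph.cycle_def pre_digraph.awalk_def)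

text \<open>
  The neighbours are the vertices before and after \<open>v\<close> in the cyclic order. They are heads of the arcs
  at two positions that differ by two modulo the length of the cycle, hence distinct as that length
  is at least three.
\<close>

lemma cycle_vertex_has_two_neighbours:
  assumes C: "C \<in> cycles G" and v: "v \<in> \<Union>C"
  shows "\<exists>u w. u \<noteq> w \<and> {v, u} \<in> C \<and> {v, w} \<in> C"
proof -
  obtain p where Cp: "C = (\<lambda>(u, v). {u, v}) ` set p"
    and cyc: "pre_digraph.cycle (with_proj G) p" and len: "3 \<le> length p"
    using C by (auto simp: cycles_def)
  define k where "k = length p"
  obtain u where "pcas u p u" and d: "distinct (tl (pawalk_verts u p))" and ne: "p \<noteq> []"
    using cyc by (auto simp: pre_digraph.cycle_def pre_digraph.awalk_def cas_with_proj_eq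
        awalk_verts_with_proj_eq)
  note walk = awalk_consecutive[OF \<open>pcas u p u\<close> ne]
  have dist: "distinct (map snd p)" using walk d by simp
  have k3: "3 \<le> k" using len by (simp add: k_def)
  have succ: "snd (p ! i) = fst (p ! (Suc i mod k))" if "i < k" for i
  proof (cases "Suc i = k")
    case True
    then have "i = length p - 1" by (simp add: k_def)
    then have "p ! i = last p" using last_conv_nth[OF ne] by simp
    then show ?thesis using walk True ne by (simp add: hd_conv_nth)
  next
    case False
    then show ?thesis using walk that by (auto simp: k_def)
  qed
  have edge: "{fst (p ! i), snd (p ! i)} \<in> C" if "i < k" for i
    unfolding Cp using that by (auto simp: k_def case_prod_beta intro!: image_eqI[of _ _ "p ! i"])
  have two: ?thesis if vj: "v = snd (p ! i)" "i < k" for i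
  proof -
    define j where "j = (i + k - 1) mod k"
    define l where "l = Suc i mod k"
    have jl: "j < k" "l < k" using k3 by (auto simp: j_def l_def)
    have ji: "Suc j mod k = i"
      using that k3 by (cases i) (auto simp: j_def mod_Suc)
    have "j \<noteq> l"
      using jl k3 unfolding l_def ji[symmetric] by (auto simp: mod_Suc split: if_splits)
    then have "snd (p ! j) \<noteq> snd (p ! l)"
      using dist jl nth_eq_iff_index_eq[OF dist, of j l] by (simp add: k_def)
    moreover have "{v, snd (p ! j)} \<in> C"
      using edge[OF \<open>i < k\<close>] succ[OF \<open>j < k\<close>] unfolding ji vj(1) by (simp add: insert_commute)
    moreover have "{v, snd (p ! l)} \<in> C"
      using edge[OF \<open>l < k\<close>] succ[OF \<open>i < k\<close>] unfolding vj(1) l_def by simp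
    ultimately show ?thesis by blast
  qed
  obtain i where i: "i < k" "v = fst (p ! i) \<or> v = snd (p ! i)"
    using v unfolding Cp by (fastforce simp: k_def in_set_conv_nth case_prod_beta)
  moreover have "fst (p ! i) = snd (p ! ((i + k - 1) mod k))"
  proof -
    have "Suc ((i + k - 1) mod k) mod k = i"
      using i k3 by (cases i) (auto simp: mod_Suc)
    then show ?thesis using succ[of "(i + k - 1) mod k"] k3 by simp
  qed
  moreover have "(i + k - 1) mod k < k" using k3 by simp
  ultimately show ?thesis using two by metis
qed

section \<open>A hexagon with a tail\<close>

text \<open>
  The hexagon together with its tail is the path through \<open>0, ..., n - 1\<close> with the chord from \<open>0\<close> to \<open>5\<close>.
  It has a tail exactly if \<open>n\<close> is at least \<open>7\<close>, and only then does \<open>5\<close> have degree three.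
\<close>

definition tailed_hexagon :: "nat \<Rightarrow> nat pair_pre_digraph" where
  "tailed_hexagon n = \<lparr> pverts = {0..<n},
     parcs = {(i, j). i < n \<and> j < n \<and>
       (j = Suc i \<or> i = Suc j \<or> i = 0 \<and> j = 5 \<or> i = 5 \<and> j = 0)} \<rparr>"

lemma pverts_tailed_hexagon [simp]: "pverts (tailed_hexagon n) = {0..<n}"
  by (simp add: tailed_hexagon_def)

lemma order_tailed_hexagon [simp]: "order (tailed_hexagon n) = n"
  by (simp add: order_def)

lemma parcs_tailed_hexagon:
  "(i, j) \<in> parcs (tailed_hexagon n) \<longleftrightarrow> i < n \<and> j < n \<and>
     (j = Suc i \<or> i = Suc j \<or> i = 0 \<and> j = 5 \<or> i = 5 \<and> j = 0)"
  by (simp add: tailed_hexagon_def)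

lemma pair_graph_tailed_hexagon: "pair_graph (tailed_hexagon n)"
proof unfold_locales
  have "parcs (tailed_hexagon n) \<subseteq> {0..<n} \<times> {0..<n}" by (auto simp: tailed_hexagon_def)
  then show "finite (parcs (tailed_hexagon n))" by (rule finite_subset) simp
qed (auto simp: tailed_hexagon_def symmetric_def sym_def arcs_ends_def arc_to_ends_def)

lemma isomorphic_imp_order_eq:
  assumes "isomorphic G H"
  shows "order G = order H"
proof -
  obtain f where f: "pre_digraph.digraph_isomorphism (with_proj G) f"
    and H: "with_proj H = app_iso f (with_proj G)"
    using assms by (auto simp: isomorphic_def digraph_iso_def)
  have "inj_on (iso_verts f) (pverts G)"
    using pre_digraph.digraph_isomorphism_inj_on_verts[OF f] by simp
  moreover have "pverts H = iso_verts f ` pverts G"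
    using arg_cong[OF H, of verts] by simp
  ultimately show ?thesis by (simp add: order_def card_image)
qed

lemma degree_conv_neighbours: "degree G v = card {w. (v, w) \<in> parcs G}"
proof -
  have "out_arcs (with_proj G) v = Pair v ` {w. (v, w) \<in> parcs G}"
    by (auto simp: out_arcs_def)
  then show ?thesis by (simp add: degree_def out_degree_def card_image inj_on_def)
qed

lemma degree_tailed_hexagon:
  assumes n: "7 \<le> n"
  shows "v < 5 \<Longrightarrow> degree (tailed_hexagon n) v = 2"
    and "degree (tailed_hexagon n) 5 = 3"
    and "5 < v \<Longrightarrow> degree (tailed_hexagon n) v \<le> 2"
proof -
  let ?N = "\<lambda>v. {w. (v, w) \<in> parcs (tailed_hexagon n)}"
  show "degree (tailed_hexagon n) v = 2" if "v < 5"
  proof (cases v)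
    case 0
    then have "?N v = {1, 5}" using n by (auto simp: parcs_tailed_hexagon)
    then show ?thesis by (simp add: degree_conv_neighbours)
  next
    case (Suc u)
    then have "?N v = {u, Suc (Suc u)}" using n that by (auto simp: parcs_tailed_hexagon)
    then show ?thesis by (simp add: degree_conv_neighbours)
  qed
  have "?N 5 = {0, 4, 6}" using n by (auto simp: parcs_tailed_hexagon)
  then show "degree (tailed_hexagon n) 5 = 3" by (simp add: degree_conv_neighbours)
  show "degree (tailed_hexagon n) v \<le> 2" if "5 < v"
  proof -
    have "?N v \<subseteq> {v - 1, Suc v}" using that by (auto simp: parcs_tailed_hexagon)
    then have "card (?N v) \<le> card {v - 1, Suc v}" by (intro card_mono) auto
    also have "\<dots> \<le> 2" by (simp add: card_insert_if)
    finally show ?thesis by (simp add: degree_conv_neighbours)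
  qed
qed

lemma max_degree_tailed_hexagon:
  assumes n: "7 \<le> n"
  shows "max_degree (tailed_hexagon n) = 3"
  unfolding max_degree_def
proof (rule Max_eqI)
  show "3 \<in> degree (tailed_hexagon n) ` pverts (tailed_hexagon n)"
    using degree_tailed_hexagon(2)[OF n] n by (intro image_eqI[of _ _ 5]) auto
  fix d assume "d \<in> degree (tailed_hexagon n) ` pverts (tailed_hexagon n)"
  then obtain v where d: "d = degree (tailed_hexagon n) v" by auto
  consider "v < 5" | "v = 5" | "5 < v" by linarith
  then show "d \<le> 3"
    using degree_tailed_hexagon(1,3)[OF n, of v] degree_tailed_hexagon(2)[OF n] unfolding d
    by cases auto
qed simp

lemma connected_tailed_hexagon:
  assumes n: "7 \<le> n"
  shows "Digraph_Component.connected (with_proj (tailed_hexagon n))"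
proof -
  let ?G = "tailed_hexagon n"
  interpret pair_graph ?G by (rule pair_graph_tailed_hexagon)
  have zero: "v < n \<Longrightarrow> 0 \<rightarrow>\<^sup>*\<^bsub>with_proj ?G\<^esub> v" for v
  proof (induction v)
    case (Suc v)
    then have "(v, Suc v) \<in> parcs ?G" by (simp add: parcs_tailed_hexagon)
    with Suc show ?case using reachable_adj_trans[of 0 v "Suc v"] by simp
  qed (use n in simp)
  have "u \<rightarrow>\<^sup>*\<^bsub>with_proj ?G\<^esub> v" if "u < n" "v < n" for u v
    using symmetric_reachable[OF sym_arcs zero[OF \<open>u < n\<close>]] zero[OF \<open>v < n\<close>]
    by (rule reachable_trans)
  then show ?thesis
    unfolding connected_def strongly_connected_def
    using n reachable_mk_symmetric_eq[OF sym_arcs] by auto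
qed

definition hexagon :: "nat set set" where
  "hexagon = insert {0, 5} ((\<lambda>i. {i, Suc i}) ` {0, 1, 2, 3, 4})"

lemma hexagon_in_cycles:
  assumes n: "7 \<le> n"
  shows "hexagon \<in> cycles (tailed_hexagon n)"
proof -
  let ?p = "[(0, 1), (1, 2), (2, 3), (3, 4), (4, 5), (5, 0)] :: (nat \<times> nat) list"
  have "pre_digraph.awalk (with_proj (tailed_hexagon n)) 0 ?p 0"
    using n by (simp add: pre_digraph.awalk_def cas_with_proj_eq parcs_tailed_hexagon)
  moreover have "distinct (tl (pre_digraph.awalk_verts (with_proj (tailed_hexagon n)) 0 ?p))"
    by (simp add: awalk_verts_with_proj_eq)
  ultimately have "pre_digraph.cycle (with_proj (tailed_hexagon n)) ?p"
    unfolding pre_digraph.cycle_def by blast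
  moreover have "(\<lambda>(u, v). {u, v}) ` set ?p = hexagon"
    by (simp add: hexagon_def insert_commute numeral_eq_Suc)
  moreover have "3 \<le> length ?p" by simp
  ultimately show ?thesis unfolding cycles_def by blast
qed

text \<open>
  A vertex other than \<open>5\<close> has at most one smaller neighbour, so the largest vertex of a cycle is \<open>5\<close>.
  The cycle thus avoids the tail, and on the hexagon every vertex has only two neighbours, both of
  which the cycle must use.
\<close>

lemma cycle_tailed_hexagon_unique:
  assumes C: "C \<in> cycles (tailed_hexagon n)"
  shows "C = hexagon"
proof -
  have adj: "u < n \<and> v < n \<and> (v = Suc u \<or> u = Suc v \<or> u = 0 \<and> v = 5 \<or> u = 5 \<and> v = 0)"
    if "{u, v} \<in> C" for u v
    using cycle_subset_edges(2)[OF C that]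
    by (auto simp: parcs_tailed_hexagon doubleton_eq_iff)
  have edges: "\<exists>u v. e = {u, v}" if "e \<in> C" for e
    using cycle_subset_edges(2)[OF C that] by blast
  have "\<Union>C \<subseteq> {..<n}" using edges adj by fastforce
  then have fin: "finite (\<Union>C)" by (rule finite_subset) simp
  have ne: "\<Union>C \<noteq> {}" using cycle_subset_edges(1)[OF C] edges by fastforce
  define M where "M = Max (\<Union>C)"
  have le: "v \<le> M" if "v \<in> \<Union>C" for v unfolding M_def using fin that by (rule Max_ge)
  have "M \<in> \<Union>C" unfolding M_def using fin ne by (rule Max_in)
  then obtain u w where "u \<noteq> w" "{M, u} \<in> C" "{M, w} \<in> C"
    using cycle_vertex_has_two_neighbours[OF C] by blast
  moreover from this have "u \<le> M" "w \<le> M" using le by blast+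
  ultimately have M5: "M = 5" using adj[of M u] adj[of M w] by linarith
  have five: "v \<le> 5" if "{u, v} \<in> C" for u v using le that M5 by blast
  \<comment> \<open>A vertex of the cycle with at most two candidates for its neighbours on it has both of them.\<close>
  have step: "{v, a} \<in> C \<and> {v, b} \<in> C"
    if "v \<in> \<Union>C" "\<And>u. {v, u} \<in> C \<Longrightarrow> u = a \<or> u = b" for v a b
    using cycle_vertex_has_two_neighbours[OF C that(1)] that(2) by metis
  have 5: "{5, 4} \<in> C \<and> {5, 0} \<in> C"
  proof (rule step)
    show "5 \<in> \<Union>C" using \<open>M \<in> \<Union>C\<close> M5 by simp
    show "u = 4 \<or> u = 0" if "{5, u} \<in> C" for u using adj[OF that] five[OF that] by linarith
  qed
  have inner: "{v, v - 1} \<in> C \<and> {v, Suc v} \<in> C" if "0 < v" "v < 5" "v \<in> \<Union>C" for v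
  proof (rule step[OF that(3)])
    show "u = v - 1 \<or> u = Suc v" if "{v, u} \<in> C" for u
      using adj[OF that] \<open>0 < v\<close> \<open>v < 5\<close> by linarith
  qed
  have 4: "{4, 3} \<in> C" using inner[of 4] 5 by auto
  have 3: "{3, 2} \<in> C" using inner[of 3] 4 by auto
  have 2: "{2, 1} \<in> C" using inner[of 2] 3 by auto
  have 1: "{1, 0} \<in> C" using inner[of 1] 2 by auto
  show ?thesis
  proof
    show "hexagon \<subseteq> C"
      using 1 2 3 4 5 by (simp add: hexagon_def insert_commute numeral_eq_Suc)
    show "C \<subseteq> hexagon"
    proof
      fix e assume e: "e \<in> C"
      then obtain u v where uv: "e = {u, v}" using edges by blast
      then have "u \<le> 5" "v \<le> 5" using five e by (metis insert_commute)+
      moreover have "v = Suc u \<or> u = Suc v \<or> u = 0 \<and> v = 5 \<or> u = 5 \<and> v = 0"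
        using adj[of u v] e unfolding uv by blast
      ultimately consider "u < 5" "v = Suc u" | "v < 5" "u = Suc v" | "u = 0" "v = 5" | "u = 5" "v = 0"
        by linarith
      then show "e \<in> hexagon"
      proof cases
        case 1
        then have "u \<in> {0, 1, 2, 3, 4}" by auto
        then show ?thesis unfolding uv 1(2) hexagon_def by blast
      next
        case 2
        then have "v \<in> {0, 1, 2, 3, 4}" by auto
        then show ?thesis unfolding uv 2(2) hexagon_def insert_commute[of "Suc v" v] by blast
      qed (simp_all add: uv hexagon_def insert_commute)
    qed
  qed
qed

lemma unicyclic_tailed_hexagon:
  assumes "7 \<le> n"
  shows "unicyclic (tailed_hexagon n)"
  unfolding unicyclic_def
  using connected_tailed_hexagon hexagon_in_cycles cycle_tailed_hexagon_unique assms by blast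

section \<open>Transfer between the antisymmetric pairs\<close>

lemma q_laplacian_carrier: "q_laplacian q G \<in> carrier_mat (order G) (order G)"
  by (simp add: q_laplacian_def adjacency_matrix_def degree_matrix_def carrier_matI)

lemma q_laplacian_entry:
  assumes "i < order G" "j < order G"
  shows "q_laplacian q G $$ (i, j) =
    (if i = j then 1 - q\<^sup>2 + q\<^sup>2 * real (degree G i) else 0) - (if (i, j) \<in> parcs G then q else 0)"
  using assms by (simp add: q_laplacian_def adjacency_matrix_def degree_matrix_def)

lemma mult_mat_vec_unit_diff:
  fixes A :: "complex mat"
  assumes "A \<in> carrier_mat n n" "a < n" "b < n" "i < n"
  shows "(A *\<^sub>v (unit_vec n a - unit_vec n b)) $ i = A $$ (i, a) - A $$ (i, b)"
  using assms by (simp add: mult_minus_distrib_mat_vec[OF assms(1)])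

text \<open>
  Both vertices in the support of \<open>x\<close> are adjacent to \<open>5\<close>, and both in the support of \<open>y\<close> to \<open>2\<close>; as
  their signs are opposite, the images vanish at \<open>5\<close> and at \<open>2\<close>.
\<close>

lemma q_laplacian_swaps_pairs:
  fixes q :: real and n :: nat
  assumes n: "7 \<le> n"
  defines "L \<equiv> map_mat complex_of_real (q_laplacian q (tailed_hexagon n))"
  defines "x \<equiv> unit_vec n 0 - unit_vec n 4" and "y \<equiv> unit_vec n 1 - unit_vec n 3"
  shows "L *\<^sub>v x = of_real (1 + q\<^sup>2) \<cdot>\<^sub>v x + of_real (- q) \<cdot>\<^sub>v y"
    and "L *\<^sub>v y = of_real (1 + q\<^sup>2) \<cdot>\<^sub>v y + of_real (- q) \<cdot>\<^sub>v x"
proof -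
  have Q: "q_laplacian q (tailed_hexagon n) \<in> carrier_mat n n"
    using q_laplacian_carrier[of q "tailed_hexagon n"] by simp
  then have L: "L \<in> carrier_mat n n" by (simp add: L_def)
  have entry: "L $$ (i, j) = of_real ((if i = j then 1 + q\<^sup>2 else 0)
      - (if (i, j) \<in> parcs (tailed_hexagon n) then q else 0))" if "i < n" "j < 5" for i j
    using that n Q q_laplacian_entry[of i "tailed_hexagon n" j q] degree_tailed_hexagon(1)[OF n, of j]
    by (auto simp: L_def)
  show "L *\<^sub>v x = of_real (1 + q\<^sup>2) \<cdot>\<^sub>v x + of_real (- q) \<cdot>\<^sub>v y"
  proof (rule eq_vecI)
    fix i assume "i < dim_vec (of_real (1 + q\<^sup>2) \<cdot>\<^sub>v x + of_real (- q) \<cdot>\<^sub>v y)"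
    then have "i < n" by (simp add: y_def)
    then show "(L *\<^sub>v x) $ i = (of_real (1 + q\<^sup>2) \<cdot>\<^sub>v x + of_real (- q) \<cdot>\<^sub>v y) $ i"
      unfolding x_def y_def using n
      by (subst mult_mat_vec_unit_diff[OF L])
        (auto simp: entry parcs_tailed_hexagon)
  qed (use L in \<open>simp add: y_def\<close>)
  show "L *\<^sub>v y = of_real (1 + q\<^sup>2) \<cdot>\<^sub>v y + of_real (- q) \<cdot>\<^sub>v x"
  proof (rule eq_vecI)
    fix i assume "i < dim_vec (of_real (1 + q\<^sup>2) \<cdot>\<^sub>v y + of_real (- q) \<cdot>\<^sub>v x)"
    then have "i < n" by (simp add: x_def)
    then show "(L *\<^sub>v y) $ i = (of_real (1 + q\<^sup>2) \<cdot>\<^sub>v y + of_real (- q) \<cdot>\<^sub>v x) $ i"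
      unfolding x_def y_def using n
      by (subst mult_mat_vec_unit_diff[OF L])
        (auto simp: entry parcs_tailed_hexagon)
  qed (use L in \<open>simp add: x_def\<close>)
qed

lemma perfect_pair_state_transfer_tailed_hexagon:
  assumes n: "7 \<le> n" and q: "q \<noteq> 0"
  shows "perfect_pair_state_transfer q (tailed_hexagon n)"
proof -
  define r where "r = complex_of_real (1 / sqrt 2)"
  define x' :: "complex vec" where "x' = unit_vec n 0 - unit_vec n 4"
  define y' :: "complex vec" where "y' = unit_vec n 1 - unit_vec n 3"
  define x where "x = r \<cdot>\<^sub>v x'"
  define y where "y = r \<cdot>\<^sub>v y'"
  define L where "L = q_laplacian q (tailed_hexagon n)"
  \<comment> \<open>The first time at which the coefficient \<open>cos (\<tau> q)\<close> of the initial state vanishes.\<close>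
  define \<tau> where "\<tau> = pi / (2 * \<bar>q\<bar>)"
  define U where "U = transition_matrix L \<tau>"
  define \<gamma> where "\<gamma> = exp (\<i> * of_real (\<tau> * (1 + q\<^sup>2))) * (\<i> * of_real (sin (\<tau> * - q)))"
  have r: "r \<noteq> 0" by (simp add: r_def)
  have x': "x' \<in> carrier_vec n" and y': "y' \<in> carrier_vec n" by (auto simp: x'_def y'_def)
  have L: "L \<in> carrier_mat n n"
    using q_laplacian_carrier[of q "tailed_hexagon n"] by (simp add: L_def)
  have U: "U \<in> carrier_mat n n" using L by (simp add: U_def transition_matrix_def mat_exp_def)
  have cos0: "cos (\<tau> * - q) = 0"
    using q cos_pi_half by (auto simp: \<tau>_def abs_if field_simps)
  have "U *\<^sub>v x' = exp (\<i> * of_real (\<tau> * (1 + q\<^sup>2))) \<cdot>\<^sub>v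
      (of_real (cos (\<tau> * - q)) \<cdot>\<^sub>v x' + (\<i> * of_real (sin (\<tau> * - q))) \<cdot>\<^sub>v y')"
    unfolding U_def
    by (rule transition_matrix_on_swapped_pair[OF L x' y'
          q_laplacian_swaps_pairs[OF n, of q, folded x'_def y'_def L_def]])
  also have "\<dots> = \<gamma> \<cdot>\<^sub>v y'"
    unfolding cos0 \<gamma>_def using x' y' by (intro eq_vecI) auto
  finally have "U *\<^sub>v x' = \<gamma> \<cdot>\<^sub>v y'" .
  then have transfer: "U *\<^sub>v x = \<gamma> \<cdot>\<^sub>v y"
    unfolding x_def y_def mult_mat_vec[OF U x'] by (simp add: smult_smult_assoc mult.commute)
  have "c = 0 \<and> d = 0" if "c \<cdot>\<^sub>v x + d \<cdot>\<^sub>v y = 0\<^sub>v n" for c d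
    using arg_cong[OF that, of "\<lambda>v. v $ 0"] arg_cong[OF that, of "\<lambda>v. v $ 1"] n r
    by (simp add: x_def y_def x'_def y'_def)
  moreover have "x \<in> pair_states n" "y \<in> pair_states n"
    unfolding pair_states_def x_def y_def x'_def y'_def r_def using n by force+
  moreover have "0 < \<tau>" using q by (simp add: \<tau>_def)
  ultimately show ?thesis
    unfolding perfect_pair_state_transfer_def order_tailed_hexagon
    using transfer unfolding U_def L_def by blast
qed

theorem corollary2:
  fixes q :: real
  assumes "q \<noteq> 0"
  shows "\<exists>\<G> :: nat pair_pre_digraph set. infinite \<G> \<and>
           (\<forall>G \<in> \<G>. \<forall>H \<in> \<G>. G \<noteq> H \<longrightarrow> \<not> isomorphic G H) \<and>
           (\<forall>G \<in> \<G>. simple_graph G \<and> unicyclic G \<and> max_degree G = 3 \<and>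
                     perfect_pair_state_transfer q G)"
proof (intro exI[of _ "tailed_hexagon ` {7..}"] conjI ballI)
  have "inj tailed_hexagon"
    by (rule injI) (metis order_tailed_hexagon)
  then show "infinite (tailed_hexagon ` {7..})"
    by (meson finite_imageD infinite_Ici inj_on_subset subset_UNIV)
next
  fix G H assume "G \<in> tailed_hexagon ` {7..}" "H \<in> tailed_hexagon ` {7..}"
  then show "G \<noteq> H \<longrightarrow> \<not> isomorphic G H"
    using isomorphic_imp_order_eq[of G H] by auto
qed (use assms in \<open>auto simp: simple_graph_def pair_graph_tailed_hexagon unicyclic_tailed_hexagon
      max_degree_tailed_hexagon perfect_pair_state_transfer_tailed_hexagon\<close>)

end
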